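(* Let $X$ be a finite-dimensional normed linear space, let $A,B\subset X$ be closed and convex, and let $\bar x\in A\cap B$. The following conditions are equivalent: (i) $\{A,B\}$ is subtransversal at $\bar x$; (ii) there exists a number $\alpha\in]0,1[$ such that $\|x_1^*+x_2^*\|>\alpha$ for all $(x_1^*,x_2^* )\in\overline N{}^c_{A,B}(\bar x)$ satisfying $\|x_1^*\|+\|x_2^*\|=1$; (iii) $\{x^*\in X^*\mid (x^*,-x^* )\in\overline N{}^c_{A,B}(\bar x)\}\subset\{0\}$. Moreover, the supremum of all $\alpha$ in (ii) equals $\mathrm{str}[A,B](\bar x)=\mathrm{str}_c[A,B](\bar x)$ (with the convention $\sup\emptyset=0$).
   Context: $\mathbb{B}_r(x)$ is the open ball with centre $x$ and radius $r$; $d(\cdot,\cdot)$ is the distance from a point to a set in the norm. Normal cone to a convex set $A$ at $x\in A$: $N_A(x)=\{x^*\in X^*\mid\langle x^*,a-x\rangle\le0\text{ for all }a\in A\}$. Subtransversality: $\{A,B\}$ is subtransversal at $\bar x\in A\cap B$ if there exist $\alpha\in]0,1[$ and $\delta>0$ such that $\alpha\, d(x,A\cap B)\le\max\{d(x,A),d(x,B)\}$ for all $x\in\mathbb{B}_\delta(\bar x)$. The number $\mathrm{str}[A,B](\bar x)$ is the supremum of all $\alpha\in]0,1[$ for which this holds for some $\delta>0$ (with $\sup\emptyset=0$). The constant $\mathrm{str}_c[A,B](\bar x)$: the limit as $\delta\downarrow0$ of the infimum of $\|x_1^*+x_2^*\|$ over all $a\in(A\setminus B)\cap\mathbb{B}_\delta(\bar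 x)$, $b\in(B\setminus A)\cap\mathbb{B}_\delta(\bar x)$, $x\in\mathbb{B}_\delta(\bar x)$ with $\|x-a\|=\|x-b\|$ and all $x_1^*,x_2^*\in X^*$ with $d(x_1^*,N_A(a))<\delta$, $d(x_2^*,N_B(b))<\delta$, $\|x_1^*\|+\|x_2^*\|=1$, $\langle x_1^*,x-a\rangle=\|x_1^*\|\|x-a\|$, $\langle x_2^*,x-b\rangle=\|x_2^*\|\|x-b\|$; the infimum over the empty set equals $1$. Pairs of restricted relative limiting normals: $(x_1^*,x_2^* )\in X^*\times X^*$ belongs to $\overline N{}^c_{A,B}(\bar x)$ if there exist sequences $(a_k)\subset A\setminus B$, $(b_k)\subset B\setminus A$, $(x_k)\subset X$, $(x_{1k}^* ),(x_{2k}^* )\subset X^*$ such that $\|x_k-a_k\|=\|x_k-b_k\|$ for all $k$, $a_k\to\bar x$, $b_k\to\bar x$, $x_k\to\bar x$, $x_{1k}^*\to x_1^*$, $x_{2k}^*\to x_2^*$, $d(x_{1k}^*,N_A(a_k))\to0$, $d(x_{2k}^*,N_B(b_k))\to0$, and $\langle x_{1k}^*,x_k-a_k\rangle=\|x_{1k}^*\|\|x_k-a_k\|$, $\langle x_{2k}^*,x_k-b_k\rangle=\|x_{2k}^*\|\|x_k-b_k\|$ for all $k$. *)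

theory Defs
  imports "HOL-Analysis.Analysis"
begin

text \<open>
  The dual space of \<open>'a\<close> is the type \<open>'a \<Rightarrow>\<^sub>L real\<close> of bounded linear functionals with
  the operator norm. On the reals \<^term>\<open>Sup\<close> and \<^term>\<open>Inf\<close> of the empty set
  carry no useful value, so the conventions for the empty set are built in explicitly.
\<close>

definition sup_or_zero :: "real set \<Rightarrow> real" where
  "sup_or_zero S = (if S = {} then 0 else Sup S)"

definition inf_or_one :: "real set \<Rightarrow> real" where
  "inf_or_one S = (if S = {} then 1 else Inf S)"

definition normal_cone :: "'a::real_normed_vector set \<Rightarrow> 'a \<Rightarrow> ('a \<Rightarrow>\<^sub>L real) set" where
  "normal_cone A x = {f. \<forall>a\<in>A. blinfun_apply f (a - x) \<le> 0}"

text \<open>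
  \<^term>\<open>infdist\<close> is the distance to a nonempty set. All sets it is applied to below are
  nonempty: the reference point lies in the intersection, and normal cones contain 0.
\<close>

definition subtransversal_with ::
    "'a::real_normed_vector set \<Rightarrow> 'a set \<Rightarrow> 'a \<Rightarrow> real \<Rightarrow> bool" where
  "subtransversal_with A B xbar \<alpha> \<longleftrightarrow>
     (\<exists>\<delta>>0. \<forall>x\<in>ball xbar \<delta>. \<alpha> * infdist x (A \<inter> B) \<le> max (infdist x A) (infdist x B))"

definition subtransversal :: "'a::real_normed_vector set \<Rightarrow> 'a set \<Rightarrow> 'a \<Rightarrow> bool" where
  "subtransversal A B xbar \<longleftrightarrow> (\<exists>\<alpha>\<in>{0<..<1}. subtransversal_with A B xbar \<alpha>)"

definition str :: "'a::real_normed_vector set \<Rightarrow> 'a set \<Rightarrow> 'a \<Rightarrow> real" where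
  "str A B xbar = sup_or_zero {\<alpha>\<in>{0<..<1}. subtransversal_with A B xbar \<alpha>}"

definition str_c_values ::
    "'a::real_normed_vector set \<Rightarrow> 'a set \<Rightarrow> 'a \<Rightarrow> real \<Rightarrow> real set" where
  "str_c_values A B xbar \<delta> =
     {norm (f + g) | f g a b x.
        a \<in> (A - B) \<inter> ball xbar \<delta> \<and> b \<in> (B - A) \<inter> ball xbar \<delta> \<and> x \<in> ball xbar \<delta> \<and>
        norm (x - a) = norm (x - b) \<and>
        infdist f (normal_cone A a) < \<delta> \<and> infdist g (normal_cone B b) < \<delta> \<and>
        norm f + norm g = 1 \<and>
        blinfun_apply f (x - a) = norm f * norm (x - a) \<and>
        blinfun_apply g (x - b) = norm g * norm (x - b)}"

definition str_c :: "'a::real_normed_vector set \<Rightarrow> 'a set \<Rightarrow> 'a \<Rightarrow> real" where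
  "str_c A B xbar = Lim (at_right 0) (\<lambda>\<delta>. inf_or_one (str_c_values A B xbar \<delta>))"

text \<open>
  The limit defining \<^term>\<open>str_c\<close> always exists, since the infimum is antitone in the
  radius and bounded by 1.
\<close>

lemma str_c_values_mono:
  assumes "\<delta> \<le> \<epsilon>"
  shows "str_c_values A B xbar \<delta> \<subseteq> str_c_values A B xbar \<epsilon>"
proof
  fix t
  assume "t \<in> str_c_values A B xbar \<delta>"
  then obtain f g a b x where
    "t = norm (f + g)" "a \<in> (A - B) \<inter> ball xbar \<delta>" "b \<in> (B - A) \<inter> ball xbar \<delta>"
    "x \<in> ball xbar \<delta>" "norm (x - a) = norm (x - b)"
    "infdist f (normal_cone A a) < \<delta>" "infdist g (normal_cone B b) < \<delta>"
    "norm f + norm g = 1"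
    "blinfun_apply f (x - a) = norm f * norm (x - a)"
    "blinfun_apply g (x - b) = norm g * norm (x - b)"
    unfolding str_c_values_def by blast
  moreover have "ball xbar \<delta> \<subseteq> ball xbar \<epsilon>"
    using assms by (rule subset_ball)
  ultimately show "t \<in> str_c_values A B xbar \<epsilon>"
    using assms unfolding str_c_values_def
    by (intro CollectI exI[of _ f] exI[of _ g] exI[of _ a] exI[of _ b] exI[of _ x]) auto
qed

lemma str_c_values_bounds:
  assumes "t \<in> str_c_values A B xbar \<delta>"
  shows "0 \<le> t" "t \<le> 1"
proof -
  obtain f g :: "'a \<Rightarrow>\<^sub>L real" where "t = norm (f + g)" "norm f + norm g = 1"
    using assms unfolding str_c_values_def by blast
  then show "0 \<le> t" "t \<le> 1"
    using norm_triangle_ineq[of f g] by auto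
qed

lemma str_c_values_bdd_below: "bdd_below (str_c_values A B xbar \<delta>)"
  using str_c_values_bounds(1) by (intro bdd_belowI) blast

lemma inf_or_one_str_c_values_le: "inf_or_one (str_c_values A B xbar \<delta>) \<le> 1"
proof (cases "str_c_values A B xbar \<delta> = {}")
  case False
  then obtain t where "t \<in> str_c_values A B xbar \<delta>" by blast
  then have "Inf (str_c_values A B xbar \<delta>) \<le> 1"
    using str_c_values_bounds(2) str_c_values_bdd_below by (meson cInf_lower2)
  then show ?thesis using False by (simp add: inf_or_one_def)
qed (simp add: inf_or_one_def)

lemma inf_or_one_str_c_values_antimono:
  assumes "\<delta> \<le> \<epsilon>"
  shows "inf_or_one (str_c_values A B xbar \<epsilon>) \<le> inf_or_one (str_c_values A B xbar \<delta>)"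
proof (cases "str_c_values A B xbar \<delta> = {}")
  case True
  then show ?thesis
    using inf_or_one_str_c_values_le[of A B xbar \<epsilon>] by (simp add: inf_or_one_def)
next
  case False
  have sub: "str_c_values A B xbar \<delta> \<subseteq> str_c_values A B xbar \<epsilon>"
    using assms by (rule str_c_values_mono)
  with False have "str_c_values A B xbar \<epsilon> \<noteq> {}" by blast
  then show ?thesis
    using False cInf_superset_mono[OF False str_c_values_bdd_below sub]
    by (simp add: inf_or_one_def)
qed

lemma tendsto_str_c:
  "((\<lambda>\<delta>. inf_or_one (str_c_values A B xbar \<delta>)) \<longlongrightarrow> str_c A B xbar) (at_right 0)"
proof -
  let ?F = "\<lambda>\<delta>. inf_or_one (str_c_values A B xbar \<delta>)"
  let ?l = "SUP \<delta>\<in>{0<..}. ?F \<delta>"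
  have bdd: "bdd_above (?F ` {0<..})"
    using inf_or_one_str_c_values_le by (intro bdd_aboveI2)
  have "(?F \<longlongrightarrow> ?l) (at_right 0)"
  proof (rule increasing_tendsto)
    show "\<forall>\<^sub>F \<delta> in at_right 0. ?F \<delta> \<le> ?l"
      using bdd
      by (auto intro!: cSUP_upper eventually_mono[OF eventually_at_right_less[of "0::real"]])
    fix y assume "y < ?l"
    then obtain \<epsilon> where \<epsilon>: "0 < \<epsilon>" "y < ?F \<epsilon>"
      using less_cSUP_iff[OF _ bdd] by auto
    show "\<forall>\<^sub>F \<delta> in at_right 0. y < ?F \<delta>"
      unfolding eventually_at_right_field
      using \<epsilon> inf_or_one_str_c_values_antimono[of _ \<epsilon> A B xbar]
      by (meson less_eq_real_def less_le_trans)
  qed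
  then show ?thesis
    unfolding str_c_def by (simp add: tendsto_Lim)
qed

definition restricted_limiting_normals ::
    "'a::real_normed_vector set \<Rightarrow> 'a set \<Rightarrow> 'a \<Rightarrow> (('a \<Rightarrow>\<^sub>L real) \<times> ('a \<Rightarrow>\<^sub>L real)) set" where
  "restricted_limiting_normals A B xbar =
     {(f, g). \<exists>(a::nat \<Rightarrow> 'a) (b::nat \<Rightarrow> 'a) (x::nat \<Rightarrow> 'a)
               (fk::nat \<Rightarrow> 'a \<Rightarrow>\<^sub>L real) (gk::nat \<Rightarrow> 'a \<Rightarrow>\<^sub>L real).
        (\<forall>k. a k \<in> A - B) \<and> (\<forall>k. b k \<in> B - A) \<and>
        (\<forall>k. norm (x k - a k) = norm (x k - b k)) \<and>
        a \<longlonglongrightarrow> xbar \<and> b \<longlonglongrightarrow> xbar \<and> x \<longlonglongrightarrow> xbar \<and>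
        fk \<longlonglongrightarrow> f \<and> gk \<longlonglongrightarrow> g \<and>
        (\<lambda>k. infdist (fk k) (normal_cone A (a k))) \<longlonglongrightarrow> 0 \<and>
        (\<lambda>k. infdist (gk k) (normal_cone B (b k))) \<longlonglongrightarrow> 0 \<and>
        (\<forall>k. blinfun_apply (fk k) (x k - a k) = norm (fk k) * norm (x k - a k)) \<and>
        (\<forall>k. blinfun_apply (gk k) (x k - b k) = norm (gk k) * norm (x k - b k))}"

end

theory Submission
  imports Defs
begin

text \<open>
  Everything rests on two estimates, one for each direction of the comparison between
  subtransversality and normals.

  If \<open>A\<close> and \<open>B\<close> are subtransversal with constant \<open>\<alpha>\<close>, then nearly normal functionals cannot nearly
  cancel. Let \<open>x\<close> be equidistant from \<open>a \<in> A - B\<close> and \<open>b \<in> B - A\<close>, with distance \<open>r\<close>, and let \<open>f\<close>, \<open>g\<close> be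
  aligned with \<open>x - a\<close> and \<open>x - b\<close> and almost normal to \<open>A\<close> at \<open>a\<close> and to \<open>B\<close> at \<open>b\<close>. For a common point \<open>c\<close>,
  the value \<open>f (x - c) + g (x - c)\<close> is almost at least \<open>(norm f + norm g) * r\<close>, so every common point
  has a distance of at least about \<open>(norm f + norm g) * r / norm (f + g)\<close> from \<open>x\<close>, while \<open>x\<close> is within \<open>r\<close> of
  both sets. Comparing the two distances gives \<open>\<alpha> * (norm f + norm g) \<le> norm (f + g)\<close> up to an error that
  vanishes in the limit (\<open>approx_normals_bound\<close>).

  If subtransversality with constant \<open>\<alpha>\<close> fails, there are exact normals with
  \<open>norm f + norm g = 1\<close> and \<open>norm (f + g) \<le> \<alpha>\<close> arbitrarily close to the reference point
  (\<open>exact_normals_of_not_subtransversal\<close>). Failure at a point \<open>x0\<close> means that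
  \<open>max (norm (y - a)) (norm (y - b)) + \<alpha> * norm (y - x0)\<close>, minimised over all \<open>y\<close>, \<open>a \<in> A\<close> and \<open>b \<in> B\<close>, attains
  its minimum at some \<open>(x, a, b)\<close> with \<open>x\<close> outside \<open>A \<inter> B\<close>. There the two distances have a common value \<open>r\<close>, since
  otherwise moving towards the farther point pays off. The functionals come from a separation argument: the
  sublinear function \<open>max (norm u) (norm v) + \<alpha> * norm w\<close> is at least \<open>r\<close> on the convex set of all
  \<open>(y - a', y - b', y - x)\<close> with \<open>a' \<in> A\<close> and \<open>b' \<in> B\<close>. A linear functional that lies below this function and is still at
  least \<open>r\<close> on the set (\<open>mazur_orlicz\<close>) has the form \<open>f u + g v - (f + g) w\<close>. Lying below the function
  yields both norm bounds, and the lower bound \<open>r\<close> yields normality and alignment.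

  Since the dual of a finite-dimensional space has compact balls, exact normals taken at shrinking
  distances accumulate at restricted limiting normals with the same bound. Hence the constants
  admissible in (ii) and the subtransversality constants below 1 differ at most in the endpoint of an
  interval, and (i), (ii), (iii) and the equality of the three numbers follow.
\<close>

section \<open>Linear functionals between a sublinear function and a convex set\<close>

definition sublinear :: "('a::real_vector \<Rightarrow> real) \<Rightarrow> bool" where
  "sublinear p \<longleftrightarrow> (\<forall>x y. p (x + y) \<le> p x + p y) \<and> (\<forall>t x. 0 \<le> t \<longrightarrow> p (t *\<^sub>R x) = t * p x)"

lemma sublinear_add: "sublinear p \<Longrightarrow> p (x + y) \<le> p x + p y"
  and sublinear_scale: "sublinear p \<Longrightarrow> 0 \<le> t \<Longrightarrow> p (t *\<^sub>R x) = t * p x"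
  by (auto simp: sublinear_def)

lemma sublinear_zero: "sublinear p \<Longrightarrow> p 0 = 0"
  using sublinear_scale[of p 0 0] by simp

lemma sublinear_minus: "sublinear p \<Longrightarrow> - p (- x) \<le> p x"
  using sublinear_add[of p x "- x"] sublinear_zero[of p] by simp

lemma sublinearI:
  assumes add: "\<And>x y. p (x + y) \<le> p x + p y"
    and zero: "p 0 = 0"
    and scale: "\<And>t x. 0 < t \<Longrightarrow> p (t *\<^sub>R x) \<le> t * p x"
  shows "sublinear p"
  unfolding sublinear_def
proof (intro conjI allI impI)
  fix t :: real and x :: 'a
  assume "0 \<le> t"
  show "p (t *\<^sub>R x) = t * p x"
  proof (cases "t = 0")
    case False
    with \<open>0 \<le> t\<close> have "0 < t" by simp
    moreover have "p x \<le> inverse t * p (t *\<^sub>R x)"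
      using scale[of "inverse t" "t *\<^sub>R x"] \<open>0 < t\<close> by simp
    ultimately show ?thesis
      using scale[of t x] by (simp add: field_simps)
  qed (simp add: zero)
qed (rule add)

text \<open>
  For convex \<open>C\<close> with \<open>r \<le> p\<close> on \<open>C\<close>, this is the largest sublinear function below \<open>p\<close> whose value at \<open>- c\<close> is at most \<open>- r\<close> for every \<open>c \<in> C\<close>. Every linear
  function below it therefore lies below \<open>p\<close> and is at least \<open>r\<close> on \<open>C\<close>.
\<close>
definition lower_along :: "('a::real_vector \<Rightarrow> real) \<Rightarrow> 'a set \<Rightarrow> real \<Rightarrow> 'a \<Rightarrow> real" where
  "lower_along p C r v = Inf {p (v + t *\<^sub>R c) - t * r | t c. 0 \<le> t \<and> c \<in> C}"

text \<open>
  The infimum is finite because \<open>- p (- v)\<close> is a lower bound, by subadditivity and \<open>r \<le> p c\<close>. Convexity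
  of \<open>C\<close> enters in subadditivity: \<open>t *\<^sub>R c + s *\<^sub>R d\<close> is \<open>t + s\<close> times a point of \<open>C\<close>.
\<close>

lemma lower_along:
  assumes p: "sublinear p" and C: "convex C" "C \<noteq> {}" and r: "\<And>c. c \<in> C \<Longrightarrow> r \<le> p c"
  shows "sublinear (lower_along p C r)"
    and "lower_along p C r v \<le> p v"
    and "c \<in> C \<Longrightarrow> lower_along p C r (- c) \<le> - r"
proof -
  let ?S = "\<lambda>v. {p (v + t *\<^sub>R c) - t * r | t c. 0 \<le> t \<and> c \<in> C}"
  let ?q = "lower_along p C r"
  obtain c0 where c0: "c0 \<in> C" using C by blast
  have lower: "- p (- v) \<le> p (v + t *\<^sub>R c) - t * r" if "0 \<le> t" "c \<in> C" for v t c
  proof -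
    have "t * r \<le> p (t *\<^sub>R c)"
      using that r sublinear_scale[OF p] by (simp add: mult_left_mono)
    then show ?thesis
      using sublinear_add[OF p, of "v + t *\<^sub>R c" "- v"] by simp
  qed
  have upper: "?q v \<le> p (v + t *\<^sub>R c) - t * r" if "0 \<le> t" "c \<in> C" for v t c
    unfolding lower_along_def
    using that by (intro cInf_lower bdd_belowI[of _ "- p (- v)"]) (auto intro: lower)
  have greatest: "m \<le> ?q v" if "\<And>t c. 0 \<le> t \<Longrightarrow> c \<in> C \<Longrightarrow> m \<le> p (v + t *\<^sub>R c) - t * r" for m v
    unfolding lower_along_def using that c0 by (intro cInf_greatest) auto
  show le: "?q v \<le> p v" for v
    using upper[of 0 c0 v] c0 by simp
  show "?q (- c) \<le> - r" if "c \<in> C"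
    using upper[of 1 c "- c"] that sublinear_zero[OF p] by simp
  show "sublinear ?q"
  proof (rule sublinearI)
    show "?q 0 = 0"
    proof (rule antisym)
      show "?q 0 \<le> 0" using le[of 0] sublinear_zero[OF p] by simp
      show "0 \<le> ?q 0"
        by (rule greatest) (use lower[of _ _ 0] sublinear_zero[OF p] in simp)
    qed
    show "?q (t *\<^sub>R x) \<le> t * ?q x" if "0 < t" for t x
    proof -
      have "inverse t * ?q (t *\<^sub>R x) \<le> ?q x"
      proof (rule greatest)
        fix s c assume "0 \<le> (s::real)" "c \<in> C"
        then have "?q (t *\<^sub>R x) \<le> p (t *\<^sub>R x + (t * s) *\<^sub>R c) - (t * s) * r"
          using that by (intro upper) auto
        also have "\<dots> = t * (p (x + s *\<^sub>R c) - s * r)"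
          using sublinear_scale[OF p, of t "x + s *\<^sub>R c"] that by (simp add: algebra_simps)
        finally show "inverse t * ?q (t *\<^sub>R x) \<le> p (x + s *\<^sub>R c) - s * r"
          using that by (simp add: field_simps)
      qed
      then show ?thesis using that by (simp add: field_simps)
    qed
    show "?q (x + y) \<le> ?q x + ?q y" for x y
    proof -
      have key: "?q (x + y) \<le> (p (x + t *\<^sub>R c) - t * r) + (p (y + s *\<^sub>R d) - s * r)"
        if ts: "0 \<le> t" "0 \<le> s" and cd: "c \<in> C" "d \<in> C" for t s c d
      proof -
        obtain e where e: "e \<in> C" "(t + s) *\<^sub>R e = t *\<^sub>R c + s *\<^sub>R d"
        proof (cases "t + s = 0")
          case True
          with ts have "t = 0" "s = 0" by auto
          then show ?thesis using c0 by (intro that[of c0]) auto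
        next
          case False
          let ?e = "(t / (t + s)) *\<^sub>R c + (s / (t + s)) *\<^sub>R d"
          have "?e \<in> C"
            using ts cd False by (intro convexD[OF C(1)]) (auto simp: add_divide_distrib[symmetric])
          moreover have "(t + s) *\<^sub>R ?e = t *\<^sub>R c + s *\<^sub>R d"
            using False by (simp add: scaleR_add_right)
          ultimately show ?thesis by (rule that)
        qed
        have "?q (x + y) \<le> p (x + y + (t + s) *\<^sub>R e) - (t + s) * r"
          using ts e by (intro upper) auto
        also have "x + y + (t + s) *\<^sub>R e = (x + t *\<^sub>R c) + (y + s *\<^sub>R d)"
          using e by simp
        finally show ?thesis
          using sublinear_add[OF p, of "x + t *\<^sub>R c" "y + s *\<^sub>R d"] by (simp add: algebra_simps)
      qed
      have "?q (x + y) - (p (y + s *\<^sub>R d) - s * r) \<le> ?q x" if "0 \<le> s" "d \<in> C" for s d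
        using key[OF _ that(1) _ that(2)] by (intro greatest) (simp add: algebra_simps)
      then have "?q (x + y) - ?q x \<le> ?q y"
        by (intro greatest) (simp add: algebra_simps)
      then show ?thesis by simp
    qed
  qed
qed

text \<open>
  Lowering \<open>p\<close> along the single point \<open>c\<close> with \<open>r = p c\<close> gives a sublinear function whose value at \<open>- c\<close> is at
  most \<open>- p c\<close>. By minimality this function is \<open>p\<close> itself, so \<open>p\<close> is odd, and an odd sublinear function is linear.
\<close>

lemma minimal_sublinear_linear:
  assumes p: "sublinear p" and min: "\<And>q. sublinear q \<Longrightarrow> q \<le> p \<Longrightarrow> q = p"
  shows "linear p"
proof -
  have neg: "p (- c) = - p c" for c
  proof -
    note low = lower_along[OF p, of "{c}" "p c"]
    have "lower_along p {c} (p c) = p"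
      using low by (intro min) (auto simp: le_fun_def)
    then have "p (- c) \<le> - p c" using low(3)[of c] by simp
    then show ?thesis using sublinear_minus[OF p, of c] by simp
  qed
  show ?thesis
  proof
    show "p (x + y) = p x + p y" for x y
      using sublinear_add[OF p, of x y] sublinear_add[OF p, of "- x" "- y"] neg[of "x + y"] neg
      by simp
    show "p (t *\<^sub>R x) = t *\<^sub>R p x" for t x
    proof (cases "0 \<le> t")
      case True
      then show ?thesis using sublinear_scale[OF p] by simp
    next
      case False
      then have "p (- ((- t) *\<^sub>R x)) = - ((- t) * p x)"
        using sublinear_scale[OF p, of "- t" x] neg by simp
      then show ?thesis by simp
    qed
  qed
qed

text \<open>
  The Hahn-Banach theorem in its algebraic form. Zorn's lemma provides a minimal sublinear function
  below \<open>p\<close>, because the pointwise infimum of a chain of sublinear functions is again sublinear.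
\<close>

lemma ex_linear_le_sublinear:
  assumes p: "sublinear (p :: 'a::real_vector \<Rightarrow> real)"
  obtains L where "linear L" "L \<le> p"
proof -
  let ?A = "{q. sublinear q \<and> q \<le> p}"
  have "\<exists>m\<in>?A. \<forall>q\<in>?A. m \<ge> q \<longrightarrow> q = m"
  proof (rule predicate_Zorn)
    show "partial_order_on ?A (relation_of (\<ge>) ?A)"
      by (rule partial_order_on_relation_ofI) auto
    fix \<C> assume "\<C> \<in> Chains (relation_of (\<ge>) ?A)"
    then have sub: "\<C> \<subseteq> ?A" and tot: "\<And>q q'. q \<in> \<C> \<Longrightarrow> q' \<in> \<C> \<Longrightarrow> q \<le> q' \<or> q' \<le> q"
      by (auto simp: Chains_def relation_of_def)
    show "\<exists>u\<in>?A. \<forall>q\<in>\<C>. q \<ge> u"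
    proof (cases "\<C> = {}")
      case True
      then show ?thesis using p by (intro bexI[of _ p]) auto
    next
      case False
      define u where "u v = (INF q\<in>\<C>. q v)" for v
      have sl: "sublinear q" if "q \<in> \<C>" for q using sub that by auto
      have lep: "q v \<le> p v" if "q \<in> \<C>" for q v using sub that by (auto simp: le_fun_def)
      have bdd: "bdd_below ((\<lambda>q. q v) ` \<C>)" for v
      proof (rule bdd_belowI2)
        fix q assume "q \<in> \<C>"
        then show "- p (- v) \<le> q v"
          using sublinear_minus[OF sl, of q v] lep[of q "- v"] by simp
      qed
      have upper: "u v \<le> q v" if "q \<in> \<C>" for q v
        unfolding u_def using bdd that by (rule cINF_lower)
      have greatest: "m \<le> u v" if "\<And>q. q \<in> \<C> \<Longrightarrow> m \<le> q v" for m v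
        unfolding u_def using False that by (rule cINF_greatest)
      have "sublinear u"
      proof (rule sublinearI)
        show "u 0 = 0"
        proof (rule antisym)
          have zero: "q 0 = 0" if "q \<in> \<C>" for q using sl[OF that] by (rule sublinear_zero)
          obtain q where "q \<in> \<C>" using False by blast
          with upper[of q 0] zero[of q] show "u 0 \<le> 0" by simp
          show "0 \<le> u 0" by (intro greatest eq_refl zero[symmetric])
        qed
        show "u (t *\<^sub>R x) \<le> t * u x" if "0 < t" for t x
        proof -
          have "inverse t * u (t *\<^sub>R x) \<le> u x"
            using upper[of _ "t *\<^sub>R x"] sublinear_scale[OF sl, of _ t x] that
            by (intro greatest) (simp add: field_simps)
          then show ?thesis using that by (simp add: field_simps)
        qed
        show "u (x + y) \<le> u x + u y" for x y
        proof -
          have key: "u (x + y) \<le> q x + q' y" if q: "q \<in> \<C>" "q' \<in> \<C>" for q q'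
          proof -
            obtain m where "m \<in> \<C>" "m \<le> q" "m \<le> q'" using tot[OF q] q by blast
            then show ?thesis
              using upper[of m "x + y"] sublinear_add[OF sl, of m x y]
              by (smt (verit) le_fun_def)
          qed
          have "u (x + y) - q' y \<le> u x" if "q' \<in> \<C>" for q'
            using key[OF _ that] by (intro greatest) (simp add: algebra_simps)
          then have "u (x + y) - u x \<le> u y"
            by (intro greatest) (simp add: algebra_simps)
          then show ?thesis by simp
        qed
      qed
      moreover have "u \<le> p"
      proof (rule le_funI)
        obtain q where "q \<in> \<C>" using False by blast
        then show "u v \<le> p v" for v using upper[of q v] lep[of q v] by simp
      qed
      ultimately show ?thesis
        using upper by (intro bexI[of _ u]) (auto simp: le_fun_def)
    qed
  qed
  then obtain m where m: "m \<in> ?A" "\<And>q. q \<in> ?A \<Longrightarrow> q \<le> m \<Longrightarrow> q = m" by blast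
  have "q = m" if "sublinear q" "q \<le> m" for q
    using m(1) that order_trans[of q m p] by (intro m(2)) auto
  then have "linear m" using m(1) by (intro minimal_sublinear_linear) auto
  then show ?thesis using m(1) by (intro that[of m]) auto
qed

text \<open>
  This is the separation theorem of Mazur and Orlicz; geometrically, \<open>L = r\<close> is a hyperplane separating \<open>C\<close>
  from the sublevel set \<open>p < r\<close>.
\<close>

lemma mazur_orlicz:
  assumes p: "sublinear p" and C: "convex C" "C \<noteq> {}" and r: "\<And>c. c \<in> C \<Longrightarrow> r \<le> p c"
  obtains L where "linear L" "L \<le> p" "\<And>c. c \<in> C \<Longrightarrow> r \<le> L c"
proof -
  note low = lower_along[OF p C r]
  obtain L where L: "linear L" "L \<le> lower_along p C r"
    using ex_linear_le_sublinear[OF low(1)] by blast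
  have "r \<le> L c" if "c \<in> C" for c
  proof -
    have "- L c \<le> lower_along p C r (- c)"
      using L by (metis le_funD linear_neg)
    then show ?thesis using low(3)[OF _ that] by simp
  qed
  moreover have "lower_along p C r \<le> p" using low(2) by (intro le_funI)
  ultimately show ?thesis using L by (intro that[of L] order_trans[of L _ p])
qed

section \<open>Compactness in finite-dimensional normed spaces and their duals\<close>

lemma compact_function_box: "compact {c :: 'b \<Rightarrow> real. \<forall>i. c i \<in> {- R..R}}"
proof -
  have "{c :: 'b \<Rightarrow> real. \<forall>i. c i \<in> {- R..R}} = PiE UNIV (\<lambda>_. {- R..R})"
    by (auto simp: PiE_def Pi_def)
  moreover have "compactin (product_topology (\<lambda>_. euclidean) UNIV) (PiE (UNIV::'b set) (\<lambda>_. {- R..R}))"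
    by (subst compactin_PiE) (simp add: compactin_euclidean_iff)
  ultimately show ?thesis
    by (simp add: euclidean_product_topology flip: compactin_euclidean_iff)
qed

lemma continuous_on_coordinate [continuous_intros]: "continuous_on S (\<lambda>c. c i :: real)"
  by (rule continuous_on_subset[OF continuous_on_product_coordinates]) simp

text \<open>
  The norm is continuous in the coordinates and nonzero on the compact \<open>l\<^sub>1\<close> unit sphere, so it has a
  positive minimum there; this makes coordinates bounded functionals. The box bounds
  the coordinates outside \<open>B\<close> as well, because its compactness is Tychonoff's theorem for all indices of the type.
\<close>

lemma independent_coordinates_bound:
  fixes B :: "'a::real_normed_vector set"
  assumes "finite B" "independent B"
  obtains m where "0 < m" "\<And>c. m * (\<Sum>b\<in>B. \<bar>c b\<bar>) \<le> norm (\<Sum>b\<in>B. c b *\<^sub>R b)"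
proof -
  let ?s = "\<lambda>c::'a \<Rightarrow> real. \<Sum>b\<in>B. \<bar>c b\<bar>"
  let ?\<Phi> = "\<lambda>c::'a \<Rightarrow> real. \<Sum>b\<in>B. c b *\<^sub>R b"
  let ?K = "{c :: 'a \<Rightarrow> real. \<forall>i. c i \<in> {- 1..1}} \<inter> {c. ?s c = 1}"
  have "closed {c::'a \<Rightarrow> real. ?s c = 1}"
    by (intro closed_Collect_eq continuous_intros)
  then have K: "compact ?K"
    by (intro compact_Int_closed compact_function_box)
  obtain m where m: "0 < m" "\<And>c. c \<in> ?K \<Longrightarrow> m \<le> norm (?\<Phi> c)"
  proof (cases "?K = {}")
    case False
    have "continuous_on ?K (\<lambda>c. norm (?\<Phi> c))"
      by (intro continuous_intros)
    then obtain c where c: "c \<in> ?K" "\<And>d. d \<in> ?K \<Longrightarrow> norm (?\<Phi> c) \<le> norm (?\<Phi> d)"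
      using continuous_attains_inf[OF K False] by blast
    have "?\<Phi> c \<noteq> 0"
    proof
      assume "?\<Phi> c = 0"
      then have "\<forall>b\<in>B. c b = 0"
        using assms independent_explicit_finite_subsets[of B] by auto
      then show False using c(1) by simp
    qed
    then show ?thesis using c by (intro that[of "norm (?\<Phi> c)"]) auto
  qed (use that[of 1] in auto)
  have "m * ?s c \<le> norm (?\<Phi> c)" for c
  proof (cases "?s c = 0")
    case False
    define s where "s = ?s c"
    have s: "0 < s" using False by (simp add: s_def sum_nonneg less_le)
    \<comment> \<open>Coordinates outside \<open>B\<close> are arbitrary and have to be reset for \<open>d\<close> to lie in the box.\<close>
    define d where "d b = (if b \<in> B then c b / s else 0)" for b
    have "\<bar>c b\<bar> \<le> s" if "b \<in> B" for b
      unfolding s_def using assms(1) that by (intro member_le_sum) auto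
    then have "\<bar>d b\<bar> \<le> 1" for b
      using s by (auto simp: d_def)
    then have "\<forall>i. d i \<in> {- 1..1}" by (simp add: abs_le_iff minus_le_iff)
    moreover have "?s d = 1"
      using s by (simp add: d_def abs_divide flip: sum_divide_distrib) (simp add: s_def)
    ultimately have "m \<le> norm (?\<Phi> d)" using m by blast
    also have "?\<Phi> d = (1 / s) *\<^sub>R ?\<Phi> c"
      by (simp add: d_def scaleR_sum_right)
    finally show ?thesis using s by (simp add: field_simps flip: s_def)
  qed (simp only: mult_zero_right norm_ge_zero)
  with m(1) show ?thesis by (rule that)
qed

lemma finite_dim_basis:
  assumes "\<exists>S::'a::real_vector set. finite S \<and> span S = UNIV"
  obtains B :: "'a::real_vector set" where "finite B" "independent B" "span B = UNIV"
proof -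
  obtain S :: "'a set" where S: "finite S" "span S = UNIV" using assms by blast
  obtain B where "B \<subseteq> S" "independent B" "S \<subseteq> span B"
    using maximal_independent_subset[of S] by blast
  then show ?thesis
    using S that[of B] by (metis finite_subset span_mono span_span top.extremum_uniqueI)
qed

text \<open>
  By the bound on coordinates, a bounded set lies in the continuous image of a compact box of
  coordinate functions.
\<close>

lemma finite_dim_compact:
  fixes K :: "'a::real_normed_vector set"
  assumes "\<exists>S::'a set. finite S \<and> span S = UNIV" "closed K" "bounded K"
  shows "compact K"
proof -
  obtain B :: "'a set" where B: "finite B" "independent B" "span B = UNIV"
    by (rule finite_dim_basis[OF assms(1)])
  obtain m where m: "0 < m" "\<And>c. m * (\<Sum>b\<in>B. \<bar>c b\<bar>) \<le> norm (\<Sum>b\<in>B. c b *\<^sub>R b)"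
    by (rule independent_coordinates_bound[OF B(1,2)]) blast
  obtain R where R: "\<And>x. x \<in> K \<Longrightarrow> norm x \<le> R"
    using assms(3) by (auto simp: bounded_iff)
  let ?\<Phi> = "\<lambda>c::'a \<Rightarrow> real. \<Sum>b\<in>B. c b *\<^sub>R b"
  let ?Q = "{c :: 'a \<Rightarrow> real. \<forall>i. c i \<in> {- (R / m)..R / m}}"
  have "compact (?\<Phi> ` ?Q)"
    by (intro compact_continuous_image compact_function_box continuous_intros)
  moreover have "K \<subseteq> ?\<Phi> ` ?Q"
  proof
    fix x assume "x \<in> K"
    define c where "c = representation B x"
    have x: "?\<Phi> c = x"
      unfolding c_def using B by (intro sum_representation_eq) auto
    have "m * (\<Sum>b\<in>B. \<bar>c b\<bar>) \<le> R"
      using m(2)[of c] R[OF \<open>x \<in> K\<close>] x by simp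
    then have s: "(\<Sum>b\<in>B. \<bar>c b\<bar>) \<le> R / m" using m(1) by (simp add: field_simps)
    have "\<bar>c b\<bar> \<le> R / m" for b
    proof (cases "b \<in> B")
      case True
      then have "\<bar>c b\<bar> \<le> (\<Sum>b\<in>B. \<bar>c b\<bar>)" using B(1) by (intro member_le_sum) auto
      then show ?thesis using s by simp
    next
      case False
      then have "c b = 0" unfolding c_def using representation_ne_zero by blast
      moreover have "0 \<le> (\<Sum>b\<in>B. \<bar>c b\<bar>)" by (rule sum_nonneg) simp
      ultimately show ?thesis using s by linarith
    qed
    then have "c \<in> ?Q" by (simp add: abs_le_iff minus_le_iff)
    then show "x \<in> ?\<Phi> ` ?Q" using x by blast
  qed
  ultimately show ?thesis
    using compact_Int_closed[OF _ assms(2), of "?\<Phi> ` ?Q"] by (simp only: inf.absorb2)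
qed

text \<open>
  The coordinate functionals of a basis are bounded and span the dual. Thus compactness of balls in
  the dual is an instance of compactness of balls in a finite-dimensional space.
\<close>

lemma finite_dim_dual:
  assumes "\<exists>S::'a::real_normed_vector set. finite S \<and> span S = UNIV"
  shows "\<exists>S::('a \<Rightarrow>\<^sub>L real) set. finite S \<and> span S = UNIV"
proof -
  obtain B :: "'a set" where B: "finite B" "independent B" "span B = UNIV"
    by (rule finite_dim_basis[OF assms])
  obtain m where m: "0 < m" "\<And>c. m * (\<Sum>b\<in>B. \<bar>c b\<bar>) \<le> norm (\<Sum>b\<in>B. c b *\<^sub>R b)"
    by (rule independent_coordinates_bound[OF B(1,2)]) blast
  define e where "e b = Blinfun (\<lambda>x. representation B x b)" for b
  have rep: "(\<Sum>b\<in>B. representation B x b *\<^sub>R b) = x" for x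
    using B by (intro sum_representation_eq) auto
  have e: "blinfun_apply (e b) x = representation B x b" if "b \<in> B" for b x
  proof -
    have "bounded_linear (\<lambda>x. representation B x b)"
    proof (rule bounded_linear_intro)
      fix x
      have "\<bar>representation B x b\<bar> \<le> (\<Sum>b\<in>B. \<bar>representation B x b\<bar>)"
        using B(1) that by (intro member_le_sum) auto
      moreover have "m * (\<Sum>b\<in>B. \<bar>representation B x b\<bar>) \<le> norm x"
        using m(2)[of "representation B x"] rep by simp
      ultimately show "norm (representation B x b) \<le> norm x * (1 / m)"
        using m(1) by (simp add: field_simps) (meson mult_left_mono order_trans less_imp_le)
    qed (use B in \<open>auto simp: representation_add representation_scale\<close>)
    then show ?thesis unfolding e_def by (simp add: bounded_linear_Blinfun_apply)
  qed
  have "f \<in> span (e ` B)" for f :: "'a \<Rightarrow>\<^sub>L real"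
  proof -
    have "f = (\<Sum>b\<in>B. blinfun_apply f b *\<^sub>R e b)"
    proof (rule blinfun_eqI)
      fix x
      have "blinfun_apply f x = blinfun_apply f (\<Sum>b\<in>B. representation B x b *\<^sub>R b)"
        using rep by simp
      then show "blinfun_apply f x = blinfun_apply (\<Sum>b\<in>B. blinfun_apply f b *\<^sub>R e b) x"
        by (simp add: blinfun.sum_left blinfun.sum_right blinfun.scaleR_left blinfun.scaleR_right e mult.commute)
    qed
    then show ?thesis
      by (metis (no_types, lifting) imageI span_base span_scale span_sum)
  qed
  then show ?thesis using B(1) by (intro exI[of _ "e ` B"]) auto
qed

section \<open>Subtransversality keeps nearly normal functionals from cancelling\<close>

lemma zero_in_normal_cone: "0 \<in> normal_cone A a"
  by (simp add: normal_cone_def)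

lemma apply_le_infdist_normal_cone:
  assumes "c \<in> A"
  shows "blinfun_apply f (c - a) \<le> infdist f (normal_cone A a) * norm (c - a)"
proof (cases "c = a")
  case False
  have "blinfun_apply f (c - a) / norm (c - a) \<le> infdist f (normal_cone A a)"
  proof (subst infdist_notempty)
    show "blinfun_apply f (c - a) / norm (c - a) \<le> (INF n\<in>normal_cone A a. dist f n)"
    proof (rule cINF_greatest)
      fix n assume "n \<in> normal_cone A a"
      then have "blinfun_apply n (c - a) \<le> 0" using assms by (simp add: normal_cone_def)
      moreover have "blinfun_apply (f - n) (c - a) \<le> dist f n * norm (c - a)"
        using norm_blinfun[of "f - n" "c - a"] by (simp add: dist_norm)
      ultimately have "blinfun_apply f (c - a) \<le> dist f n * norm (c - a)"
        by (simp add: blinfun.diff_left)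
      then show "blinfun_apply f (c - a) / norm (c - a) \<le> dist f n"
        using False by (simp add: pos_divide_le_eq)
    qed (use zero_in_normal_cone in blast)
  qed (use zero_in_normal_cone in blast)
  then show ?thesis using False by (simp add: pos_divide_le_eq)
qed simp

text \<open>
  With \<open>r\<close> the common distance of \<open>x\<close> from \<open>a\<close> and \<open>b\<close>, alignment and approximate normality show that
  every common point \<open>c\<close> satisfies \<open>s * r \<le> K * norm (x - c)\<close>, where \<open>s\<close> and \<open>K\<close> are \<open>norm f + norm g\<close> and
  \<open>norm (f + g)\<close> corrected by \<open>2 * \<epsilon>\<close>. Subtransversality at \<open>x\<close> bounds \<open>\<alpha>\<close> times the distance from the intersection by \<open>r\<close>.
\<close>

lemma approx_normals_bound:
  assumes "0 \<le> \<alpha>" "A \<inter> B \<noteq> {}" "a \<in> A - B" "b \<in> B"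
    and xr: "norm (x - a) = norm (x - b)"
    and f: "blinfun_apply f (x - a) = norm f * norm (x - a)" "infdist f (normal_cone A a) \<le> \<epsilon>"
    and g: "blinfun_apply g (x - b) = norm g * norm (x - b)" "infdist g (normal_cone B b) \<le> \<epsilon>"
    and sub: "\<alpha> * infdist x (A \<inter> B) \<le> max (infdist x A) (infdist x B)"
  shows "\<alpha> * (norm f + norm g - 2 * \<epsilon>) \<le> norm (f + g) + 2 * \<epsilon>"
proof -
  define r where "r = norm (x - a)"
  define s where "s = norm f + norm g - 2 * \<epsilon>"
  define K where "K = norm (f + g) + 2 * \<epsilon>"
  define d where "d = infdist x (A \<inter> B)"
  have \<epsilon>: "0 \<le> \<epsilon>" using f(2) infdist_nonneg order_trans by blast
  have K: "0 \<le> K" using \<epsilon> by (simp add: K_def)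
  have r: "0 < r" using assms(3,4) xr by (auto simp: r_def)
  show ?thesis
  proof (cases "s \<le> 0")
    case True
    then have "\<alpha> * s \<le> 0" using assms(1) by (simp add: mult_nonneg_nonpos)
    then show ?thesis using K by (simp add: s_def K_def)
  next
    case False
    have le: "s * r \<le> K * norm (x - c)" if c: "c \<in> A \<inter> B" for c
    proof -
      have "blinfun_apply f (c - a) \<le> \<epsilon> * norm (c - a)"
        using apply_le_infdist_normal_cone[of c A f a] c f(2) mult_right_mono[of _ \<epsilon> "norm (c - a)"]
        by fastforce
      also have "\<dots> \<le> \<epsilon> * (norm (x - c) + r)"
        using \<epsilon> norm_triangle_ineq[of "c - x" "x - a"]
        by (intro mult_left_mono) (simp_all add: r_def norm_minus_commute)
      finally have 1: "blinfun_apply f (c - a) \<le> \<epsilon> * (norm (x - c) + r)" .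
      have "blinfun_apply g (c - b) \<le> \<epsilon> * norm (c - b)"
        using apply_le_infdist_normal_cone[of c B g b] c g(2) mult_right_mono[of _ \<epsilon> "norm (c - b)"]
        by fastforce
      also have "\<dots> \<le> \<epsilon> * (norm (x - c) + r)"
        using \<epsilon> norm_triangle_ineq[of "c - x" "x - b"] xr
        by (intro mult_left_mono) (simp_all add: r_def norm_minus_commute)
      finally have 2: "blinfun_apply g (c - b) \<le> \<epsilon> * (norm (x - c) + r)" .
      have "blinfun_apply (f + g) (x - c)
          = (blinfun_apply f (x - a) - blinfun_apply f (c - a))
            + (blinfun_apply g (x - b) - blinfun_apply g (c - b))"
        by (simp add: blinfun.add_left blinfun.diff_right)
      moreover have "blinfun_apply (f + g) (x - c) \<le> norm (f + g) * norm (x - c)"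
        using norm_blinfun[of "f + g" "x - c"] by simp
      ultimately show ?thesis
        using 1 2 f(1) g(1) xr by (simp add: r_def s_def K_def algebra_simps)
    qed
    have sr: "0 < s * r" using False r by simp
    obtain c0 where "c0 \<in> A \<inter> B" using assms(2) by blast
    with le sr have "0 < K * norm (x - c0)" by fastforce
    with K have K: "0 < K" by (simp add: zero_less_mult_iff)
    have "s * r / K \<le> d"
      unfolding d_def infdist_notempty[OF assms(2)] dist_norm
      using assms(2) K le by (intro cINF_greatest) (auto simp: pos_divide_le_eq mult.commute)
    then have srd: "s * r \<le> K * d" using K by (simp add: field_simps)
    then have d: "0 < d" using sr K by (meson less_le_trans zero_less_mult_pos)
    have "infdist x A \<le> r" "infdist x B \<le> r"
      using assms(3,4) xr infdist_le[of a A x] infdist_le[of b B x] by (auto simp: r_def dist_norm)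
    then have "\<alpha> * d \<le> r" using sub by (simp add: d_def)
    then have "s * (\<alpha> * d) \<le> K * d"
      using srd False mult_left_mono[of "\<alpha> * d" r s] by linarith
    then have "(\<alpha> * s) * d \<le> K * d" by (simp add: ac_simps)
    then show ?thesis using d by (simp add: s_def K_def)
  qed
qed

section \<open>Exact normals where subtransversality fails\<close>

lemma norm_blinfun_le_onesided:
  fixes f :: "'a::real_normed_vector \<Rightarrow>\<^sub>L real"
  assumes "0 \<le> K" "\<And>u. blinfun_apply f u \<le> K * norm u"
  shows "norm f \<le> K"
proof (rule norm_blinfun_bound[OF assms(1)])
  fix u show "norm (blinfun_apply f u) \<le> K * norm u"
    using assms(2)[of u] assms(2)[of "- u"] by (simp add: blinfun.minus_right abs_le_iff)
qed

text \<open>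
  The norm dual to the maximum norm on a product is the sum of the dual norms. Scaling \<open>u\<close> by \<open>norm v\<close> and
  \<open>v\<close> by \<open>norm u\<close> makes their norms equal, which avoids approximating the operator norms.
\<close>

lemma norm_add_norm_le_one:
  fixes f g :: "'a::real_normed_vector \<Rightarrow>\<^sub>L real"
  assumes fg: "\<And>u v. blinfun_apply f u + blinfun_apply g v \<le> max (norm u) (norm v)"
  shows "norm f + norm g \<le> 1"
proof -
  have hom: "norm v * blinfun_apply f u + norm u * blinfun_apply g v \<le> norm u * norm v" for u v
    using fg[of "norm v *\<^sub>R u" "norm u *\<^sub>R v"] by (simp add: blinfun.scaleR_right mult.commute)
  have f1: "norm f \<le> 1"
    using fg[of _ 0] by (intro norm_blinfun_le_onesided) auto
  have "blinfun_apply g v \<le> (1 - norm f) * norm v" for v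
  proof (cases "v = 0")
    case False
    then have v: "0 < norm v" by simp
    have "blinfun_apply g v \<le> norm v" using fg[of 0 v] by simp
    moreover have "blinfun_apply f u \<le> (1 - blinfun_apply g v / norm v) * norm u" for u
      using hom[of v u] v by (simp add: field_simps)
    ultimately have "norm f \<le> 1 - blinfun_apply g v / norm v"
      using v by (intro norm_blinfun_le_onesided) auto
    then show ?thesis using v by (simp add: field_simps)
  qed simp
  then have "norm g \<le> 1 - norm f"
    using f1 by (intro norm_blinfun_le_onesided) auto
  then show ?thesis by simp
qed

text \<open>
  The minimality assumption says that the sublinear \<open>P\<close> is at least \<open>r\<close> on the convex set \<open>C\<close>. A separating
  functional has the form \<open>f u + g v + h w\<close>. Since \<open>y\<close> ranges over the whole space, the lower bound \<open>r\<close>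
  forces \<open>f + g + h = 0\<close>, so that \<open>norm (f + g) \<le> \<alpha>\<close> comes from \<open>h\<close>. What remains is
  \<open>r \<le> f (x - a') + g (x - b')\<close> on \<open>A \<times> B\<close>. At \<open>(a, b)\<close> the right-hand side is at most
  \<open>(norm f + norm g) * r \<le> r\<close>, so equality holds throughout. This gives the alignment and the normalisation, and it
  shows that \<open>(a, b)\<close> minimises the right-hand side, which is the normality.
\<close>

lemma exact_normals_at_minimum:
  fixes A B :: "'a::real_normed_vector set"
  assumes "convex A" "convex B" "a \<in> A" "b \<in> B" "0 \<le> \<alpha>" "0 < r"
    and xa: "norm (x - a) = r" and xb: "norm (x - b) = r"
    and min: "\<And>y a' b'. a' \<in> A \<Longrightarrow> b' \<in> B \<Longrightarrow>
      r \<le> max (norm (y - a')) (norm (y - b')) + \<alpha> * norm (y - x)"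
  obtains f g where "f \<in> normal_cone A a" "g \<in> normal_cone B b" "norm f + norm g = 1"
    "blinfun_apply f (x - a) = norm f * norm (x - a)"
    "blinfun_apply g (x - b) = norm g * norm (x - b)"
    "norm (f + g) \<le> \<alpha>"
proof -
  define P :: "'a \<times> 'a \<times> 'a \<Rightarrow> real"
    where "P = (\<lambda>(u, v, w). max (norm u) (norm v) + \<alpha> * norm w)"
  define C where "C = {(y - a', y - b', y - x) | y a' b'. a' \<in> A \<and> b' \<in> B}"
  have "sublinear P"
  proof (rule sublinearI)
    show "P (z + z') \<le> P z + P z'" for z z'
    proof -
      obtain u v w u' v' w' where z: "z = (u, v, w)" "z' = (u', v', w')" by (metis prod_cases3)
      show ?thesis
        using mult_left_mono[OF norm_triangle_ineq[of w w'] assms(5)]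
          norm_triangle_ineq[of u u'] norm_triangle_ineq[of v v']
        by (auto simp: P_def z algebra_simps max_def)
    qed
    show "P (t *\<^sub>R z) \<le> t * P z" if "0 < t" for t z
    proof -
      obtain u v w where z: "z = (u, v, w)" by (rule prod_cases3)
      show ?thesis using that by (simp add: P_def z algebra_simps max_mult_distrib_left)
    qed
  qed (simp add: P_def zero_prod_def)
  moreover have "convex C"
  proof (rule convexI)
    fix z z' and t s :: real
    assume "z \<in> C" "z' \<in> C" and ts: "0 \<le> t" "0 \<le> s" "t + s = 1"
    then obtain y a1 b1 y' a2 b2 where z: "z = (y - a1, y - b1, y - x)" "z' = (y' - a2, y' - b2, y' - x)"
      and mem: "a1 \<in> A" "b1 \<in> B" "a2 \<in> A" "b2 \<in> B"
      unfolding C_def by blast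
    have "t *\<^sub>R x + s *\<^sub>R x = x" using ts by (simp flip: scaleR_add_left)
    then have "t *\<^sub>R z + s *\<^sub>R z' = ((t *\<^sub>R y + s *\<^sub>R y') - (t *\<^sub>R a1 + s *\<^sub>R a2),
        (t *\<^sub>R y + s *\<^sub>R y') - (t *\<^sub>R b1 + s *\<^sub>R b2), (t *\<^sub>R y + s *\<^sub>R y') - x)"
      by (simp add: z algebra_simps)
    then show "t *\<^sub>R z + s *\<^sub>R z' \<in> C"
      unfolding C_def using convexD[OF assms(1) mem(1,3) ts] convexD[OF assms(2) mem(2,4) ts] by blast
  qed
  moreover have "C \<noteq> {}" using assms(3,4) by (auto simp: C_def)
  moreover have "r \<le> P c" if "c \<in> C" for c
    using that min by (auto simp: C_def P_def)
  ultimately obtain L where L: "linear L" "L \<le> P" "\<And>c. c \<in> C \<Longrightarrow> r \<le> L c"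
    by (rule mazur_orlicz) auto
  have LP: "L (u, v, w) \<le> max (norm u) (norm v) + \<alpha> * norm w" for u v w
    using L(2) by (auto simp: le_fun_def P_def)
  have Ladd: "L (u + u', v + v', w + w') = L (u, v, w) + L (u', v', w')" for u v w u' v' w'
    using linear_add[OF L(1), of "(u, v, w)" "(u', v', w')"] by simp
  have Lscale: "L (t *\<^sub>R u, t *\<^sub>R v, t *\<^sub>R w) = t * L (u, v, w)" for t u v w
    using linear_scale[OF L(1), of t "(u, v, w)"] by simp
  have Lneg: "L (- u, - v, - w) = - L (u, v, w)" for u v w
    using Lscale[of "-1" u v w] by simp
  define f where "f = Blinfun (\<lambda>u. L (u, 0, 0))"
  define g where "g = Blinfun (\<lambda>v. L (0, v, 0))"
  define h where "h w = L (0, 0, w)" for w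
  have "bounded_linear (\<lambda>u. L (u, 0, 0))"
  proof (rule bounded_linear_intro[where K = 1])
    show "norm (L (u, 0, 0)) \<le> norm u * 1" for u
      using LP[of u 0 0] LP[of "- u" 0 0] Lneg[of u 0 0] by (simp add: abs_le_iff)
  qed (use Ladd[of _ _ 0 0 0 0] Lscale[of _ _ 0 0] in simp_all)
  then have f: "blinfun_apply f u = L (u, 0, 0)" for u
    by (simp add: f_def bounded_linear_Blinfun_apply)
  have "bounded_linear (\<lambda>v. L (0, v, 0))"
  proof (rule bounded_linear_intro[where K = 1])
    show "norm (L (0, v, 0)) \<le> norm v * 1" for v
      using LP[of 0 v 0] LP[of 0 "- v" 0] Lneg[of 0 v 0] by (simp add: abs_le_iff)
  qed (use Ladd[of 0 0 _ _ 0 0] Lscale[of _ 0 _ 0] in simp_all)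
  then have g: "blinfun_apply g v = L (0, v, 0)" for v
    by (simp add: g_def bounded_linear_Blinfun_apply)
  have L_eq: "L (u, v, w) = blinfun_apply f u + blinfun_apply g v + h w" for u v w
    using Ladd[of u 0 0 v 0 w] Ladd[of 0 0 v 0 0 w] by (simp add: f g h_def)
  have fgh: "r \<le> blinfun_apply f (y - a') + blinfun_apply g (y - b') + h (y - x)"
    if "a' \<in> A" "b' \<in> B" for y a' b'
    using L(3)[of "(y - a', y - b', y - x)"] that by (auto simp: C_def L_eq)
  have h: "h w = - blinfun_apply (f + g) w" for w
  proof (rule ccontr)
    define \<phi> where "\<phi> = blinfun_apply f w + blinfun_apply g w + h w"
    assume "h w \<noteq> - blinfun_apply (f + g) w"
    then have "\<phi> \<noteq> 0" by (auto simp: \<phi>_def blinfun.add_left)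
    define k where "k = r - blinfun_apply f (x - a) - blinfun_apply g (x - b)"
    have "k \<le> t * \<phi>" for t
    proof -
      have "h (t *\<^sub>R w) = t * h w" using Lscale[of t 0 0 w] by (simp add: h_def)
      then show ?thesis
        using fgh[OF assms(3,4), of "x + t *\<^sub>R w"]
        by (simp add: k_def \<phi>_def blinfun.add_right blinfun.diff_right blinfun.scaleR_right algebra_simps)
    qed
    \<comment> \<open>A nonzero linear function of \<open>t\<close> takes the value \<open>k - 1\<close>.\<close>
    from this[of "(k - 1) / \<phi>"] show False using \<open>\<phi> \<noteq> 0\<close> by simp
  qed
  have "h 0 = 0" using h by simp
  have sep: "r \<le> blinfun_apply f (x - a') + blinfun_apply g (x - b')" if "a' \<in> A" "b' \<in> B" for a' b'
    using fgh[OF that, of x] \<open>h 0 = 0\<close> by simp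
  have sum_le: "norm f + norm g \<le> 1"
    using LP[of _ _ 0] \<open>h 0 = 0\<close> by (intro norm_add_norm_le_one) (simp add: L_eq)
  have fa: "blinfun_apply f (x - a) \<le> norm f * r" and gb: "blinfun_apply g (x - b) \<le> norm g * r"
    using norm_blinfun[of f "x - a"] norm_blinfun[of g "x - b"] xa xb by auto
  have "r \<le> norm f * r + norm g * r"
    using sep[OF assms(3,4)] fa gb by simp
  then have "1 * r \<le> (norm f + norm g) * r" by (simp add: algebra_simps)
  then have "1 \<le> norm f + norm g" using assms(6) by simp
  with sum_le have sum: "norm f + norm g = 1" by simp
  then have "norm f * r + norm g * r = r" by (simp flip: distrib_right)
  with sep[OF assms(3,4)] fa gb
  have eq: "blinfun_apply f (x - a) = norm f * r" "blinfun_apply g (x - b) = norm g * r"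
    "blinfun_apply f (x - a) + blinfun_apply g (x - b) = r"
    by auto
  show ?thesis
  proof (rule that)
    show "f \<in> normal_cone A a"
      using sep[OF _ assms(4)] eq(3) by (fastforce simp: normal_cone_def blinfun.diff_right)
    show "g \<in> normal_cone B b"
      using sep[OF assms(3)] eq(3) by (fastforce simp: normal_cone_def blinfun.diff_right)
    show "norm (f + g) \<le> \<alpha>"
    proof (rule norm_blinfun_le_onesided[OF assms(5)])
      show "blinfun_apply (f + g) u \<le> \<alpha> * norm u" for u
        using LP[of 0 0 "- u"] h[of "- u"] by (simp add: h_def blinfun.minus_right)
    qed
  qed (use sum eq xa xb in auto)
qed

lemma infdist_lessE:
  assumes "infdist x A < m" "A \<noteq> {}"
  obtains a where "a \<in> A" "dist x a < m"
  using assms by (auto simp: infdist_notempty cINF_less_iff bounded_imp_bdd_below)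

text \<open>
  Failure of the inequality at \<open>x0\<close> allows a starting value of \<open>F\<close> below \<open>\<alpha> * D\<close>, where \<open>D\<close> is the distance of \<open>x0\<close> from \<open>A \<inter> B\<close>.
  Hence every minimiser \<open>(x, a, b)\<close> has \<open>x\<close> closer to \<open>x0\<close> than \<open>D\<close>, so \<open>x\<close> is not a common point, and all three
  components stay close to the reference point. Because \<open>\<alpha> < 1\<close>, a step from \<open>x\<close> towards a point at distance \<open>r\<close>
  costs less in the penalty than it gains in distance; this excludes unequal distances and excludes \<open>a \<in> B\<close> and \<open>b \<in> A\<close>.
\<close>

lemma exact_normals_of_not_subtransversal:
  fixes A B :: "'a::real_normed_vector set"
  assumes fin: "\<exists>S::'a set. finite S \<and> span S = UNIV"
    and A: "closed A" "convex A" and B: "closed B" "convex B"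
    and xbar: "xbar \<in> A \<inter> B"
    and \<alpha>: "0 < \<alpha>" "\<alpha> < 1" and not_sub: "\<not> subtransversal_with A B xbar \<alpha>" and "0 < \<delta>"
  obtains f g a b x where
    "a \<in> (A - B) \<inter> ball xbar \<delta>" "b \<in> (B - A) \<inter> ball xbar \<delta>" "x \<in> ball xbar \<delta>"
    "norm (x - a) = norm (x - b)" "f \<in> normal_cone A a" "g \<in> normal_cone B b"
    "norm f + norm g = 1"
    "blinfun_apply f (x - a) = norm f * norm (x - a)"
    "blinfun_apply g (x - b) = norm g * norm (x - b)"
    "norm (f + g) \<le> \<alpha>"
proof -
  have "0 < \<delta> / 3" using \<open>0 < \<delta>\<close> by simp
  then obtain x0 where x0: "x0 \<in> ball xbar (\<delta> / 3)"
    and less: "max (infdist x0 A) (infdist x0 B) < \<alpha> * infdist x0 (A \<inter> B)"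
    using not_sub unfolding subtransversal_with_def by (meson not_le)
  define D where "D = infdist x0 (A \<inter> B)"
  have D: "D < \<delta> / 3"
    using infdist_le[OF xbar, of x0] x0 by (simp add: D_def dist_commute)
  obtain a0 where a0: "a0 \<in> A" "norm (x0 - a0) < \<alpha> * D"
    using less xbar infdist_lessE[of x0 A "\<alpha> * D"] by (auto simp: D_def dist_norm)
  obtain b0 where b0: "b0 \<in> B" "norm (x0 - b0) < \<alpha> * D"
    using less xbar infdist_lessE[of x0 B "\<alpha> * D"] by (auto simp: D_def dist_norm)
  define F where "F = (\<lambda>(y, a, b). max (norm (y - a)) (norm (y - b)) + \<alpha> * norm (y - x0))"
  \<comment> \<open>A value of \<open>F\<close> below \<open>\<alpha> * D\<close> forces \<open>norm (y - x0) < D\<close> and \<open>norm (y - a) < \<alpha> * D\<close>, so \<open>K\<close> contains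
     all such triples.\<close>
  define R where "R = D + \<alpha> * D"
  define K where "K = cball x0 R \<times> (A \<inter> cball x0 R) \<times> (B \<inter> cball x0 R)"
  have "0 < \<alpha> * D" using a0(2) norm_ge_zero[of "x0 - a0"] by linarith
  then have D0: "0 < D" using \<alpha> by (simp add: zero_less_mult_iff)
  have "compact (cball x0 R)"
    using fin by (intro finite_dim_compact) auto
  then have "compact K"
    unfolding K_def using A(1) B(1) by (intro compact_Times closed_Int_compact)
  moreover have start: "(x0, a0, b0) \<in> K"
    using a0 b0 D0 \<open>0 < \<alpha> * D\<close> by (simp add: K_def R_def dist_norm)
  moreover have "continuous_on K F"
    unfolding F_def case_prod_beta by (intro continuous_intros)
  ultimately obtain x a b where xab: "(x, a, b) \<in> K" and "\<And>z. z \<in> K \<Longrightarrow> F (x, a, b) \<le> F z"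
    by (metis (no_types, lifting) continuous_attains_inf empty_iff prod_cases3)
  have F0: "F (x0, a0, b0) < \<alpha> * D" using a0 b0 by (simp add: F_def)
  have m: "F (x, a, b) < \<alpha> * D"
    using \<open>\<And>z. z \<in> K \<Longrightarrow> F (x, a, b) \<le> F z\<close>[OF start] F0 by simp
  have glob: "F (x, a, b) \<le> F (y, a', b')" if "a' \<in> A" "b' \<in> B" for y a' b'
  proof (cases "F (y, a', b') < \<alpha> * D")
    case True
    define M where "M = max (norm (y - a')) (norm (y - b'))"
    have M: "norm (y - a') \<le> M" "norm (y - b') \<le> M" by (simp_all add: M_def)
    have "M + \<alpha> * norm (y - x0) < \<alpha> * D" using True by (simp add: F_def M_def)
    moreover have "0 \<le> \<alpha> * norm (y - x0)" using \<alpha> by simp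
    ultimately have ya: "norm (y - a') < \<alpha> * D" and yb: "norm (y - b') < \<alpha> * D"
      and "\<alpha> * norm (y - x0) < \<alpha> * D"
      using M norm_ge_zero[of "y - a'"] by linarith+
    then have yx: "norm (y - x0) < D" using \<alpha> by simp
    have "norm (x0 - a') \<le> R" "norm (x0 - b') \<le> R"
      using norm_triangle_ineq[of "x0 - y" "y - a'"] norm_triangle_ineq[of "x0 - y" "y - b'"] ya yb yx
      by (auto simp: R_def norm_minus_commute)
    moreover have "norm (x0 - y) \<le> R"
      using yx \<open>0 < \<alpha> * D\<close> by (simp add: R_def norm_minus_commute)
    ultimately have "(y, a', b') \<in> K" using that by (simp add: K_def dist_norm)
    then show ?thesis by fact
  next
    case False
    then show ?thesis using m by simp
  qed
  have aA: "a \<in> A" and bB: "b \<in> B" using xab by (auto simp: K_def)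
  define r where "r = max (norm (x - a)) (norm (x - b))"
  have min: "r \<le> max (norm (y - a')) (norm (y - b')) + \<alpha> * norm (y - x)"
    if "a' \<in> A" "b' \<in> B" for y a' b'
  proof -
    have "\<alpha> * norm (y - x0) \<le> \<alpha> * (norm (y - x) + norm (x - x0))"
      using \<alpha> norm_triangle_ineq[of "y - x" "x - x0"] by (intro mult_left_mono) auto
    then have "\<alpha> * norm (y - x0) \<le> \<alpha> * norm (y - x) + \<alpha> * norm (x - x0)"
      by (simp only: distrib_left)
    moreover have "r + \<alpha> * norm (x - x0) \<le> max (norm (y - a')) (norm (y - b')) + \<alpha> * norm (y - x0)"
      using glob[OF that, of y] by (simp only: F_def r_def prod.case)
    ultimately show ?thesis by linarith
  qed
  have rm: "r + \<alpha> * norm (x - x0) < \<alpha> * D" using m by (simp add: F_def r_def)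
  have r0: "0 \<le> r" by (simp add: r_def le_max_iff_disj)
  have "\<alpha> * norm (x - x0) < \<alpha> * D" using rm r0 by linarith
  then have xx0: "norm (x - x0) < D" using \<alpha> by simp
  have notAB: "x \<notin> A \<inter> B"
    using infdist_le[of x "A \<inter> B" x0] xx0 by (auto simp: D_def dist_norm norm_minus_commute)
  have r: "0 < r"
  proof (rule ccontr)
    assume "\<not> 0 < r"
    then have "norm (x - a) \<le> 0" "norm (x - b) \<le> 0"
      using max.cobounded1 max.cobounded2 unfolding r_def by (meson not_le order_trans)+
    then have "x = a" "x = b" by (simp_all only: norm_le_zero_iff right_minus_eq)
    then show False using aA bB notAB by blast
  qed
  have not_less: "\<not> (norm (x - c) < norm (x - c'))"
    if c: "max (norm (x - c)) (norm (x - c')) = r"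
      and min': "\<And>y. r \<le> max (norm (y - c)) (norm (y - c')) + \<alpha> * norm (y - x)" for c c'
  proof
    assume lt: "norm (x - c) < norm (x - c')"
    then have c': "norm (x - c') = r" using c by simp
    \<comment> \<open>A fraction \<open>t\<close> of the way to \<open>c'\<close> moves \<open>y\<close> by \<open>t * r\<close>; this \<open>t\<close> makes the bound on the distance
       from \<open>c\<close>, namely \<open>norm (x - c) + t * r\<close>, equal to the new distance \<open>(1 - t) * r\<close> from \<open>c'\<close>.\<close>
    define t where "t = (r - norm (x - c)) / (2 * r)"
    have t2: "norm (x - c) = r - 2 * (t * r)" using r by (simp add: t_def field_simps)
    have t0: "0 < t" using lt c' r by (simp add: t_def)
    have "r - norm (x - c) \<le> 2 * r" using r norm_ge_zero[of "x - c"] by linarith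
    then have t1: "t \<le> 1" using r by (simp add: t_def)
    define y where "y = x + t *\<^sub>R (c' - x)"
    have yx: "norm (y - x) = t * r"
      using t0 c' by (simp add: y_def norm_minus_commute)
    have "y - c' = (1 - t) *\<^sub>R (x - c')" by (simp add: y_def algebra_simps)
    then have "norm (y - c') = (1 - t) * r" using t1 c' by simp
    moreover have "norm (y - c) \<le> (1 - t) * r"
    proof -
      have "norm (y - c) \<le> t * r + norm (x - c)"
        using norm_triangle_ineq[of "y - x" "x - c"] yx by simp
      also have "\<dots> = (1 - t) * r" unfolding t2 by (simp add: left_diff_distrib)
      finally show ?thesis .
    qed
    ultimately have "max (norm (y - c)) (norm (y - c')) \<le> (1 - t) * r" by simp
    then have "r \<le> (1 - t) * r + \<alpha> * (t * r)"
      using min'[of y] unfolding yx by linarith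
    then have "t * r \<le> \<alpha> * (t * r)" by (simp add: left_diff_distrib)
    moreover have "\<alpha> * (t * r) < 1 * (t * r)"
      using \<alpha> t0 r by (intro mult_strict_right_mono) auto
    ultimately show False by simp
  qed
  have "norm (x - a) = norm (x - b)"
  proof (rule antisym; rule leI)
    show "\<not> norm (x - b) < norm (x - a)"
      using min[OF aA bB] by (intro not_less) (simp_all add: r_def max.commute)
    show "\<not> norm (x - a) < norm (x - b)"
      using min[OF aA bB] by (intro not_less) (simp_all add: r_def)
  qed
  then have xa: "norm (x - a) = r" and xb: "norm (x - b) = r" by (auto simp: r_def)
  have "\<alpha> * r < r" using \<alpha> r by simp
  \<comment> \<open>If \<open>a\<close> were a common point, then \<open>y = a' = b' = a\<close> would give the value \<open>\<alpha> * r < r\<close>.\<close>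
  have "a \<notin> B"
    using min[OF aA, of a a] xa \<open>\<alpha> * r < r\<close> by (auto simp: norm_minus_commute)
  have "b \<notin> A"
    using min[OF _ bB, of b b] xb \<open>\<alpha> * r < r\<close> by (auto simp: norm_minus_commute)
  have "\<alpha> * D < D" using \<alpha> D0 by simp
  moreover have "0 \<le> \<alpha> * norm (x - x0)" using \<alpha> by simp
  ultimately have rD: "r < D" using rm by linarith
  have d1: "dist xbar x < 2 * (\<delta> / 3)"
    using xx0 D x0 dist_triangle[of xbar x x0] by (simp add: dist_norm norm_minus_commute)
  have d2: "dist xbar a < \<delta>" "dist xbar b < \<delta>"
    using d1 rD D xa xb dist_triangle[of xbar a x] dist_triangle[of xbar b x]
    by (auto simp: dist_norm)
  obtain f g where "f \<in> normal_cone A a" "g \<in> normal_cone B b" "norm f + norm g = 1"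
    "blinfun_apply f (x - a) = norm f * norm (x - a)"
    "blinfun_apply g (x - b) = norm g * norm (x - b)"
    "norm (f + g) \<le> \<alpha>"
    by (rule exact_normals_at_minimum[OF A(2) B(2) aA bB _ r xa xb min]) (use \<alpha> in auto)
  then show ?thesis
    using aA bB \<open>a \<notin> B\<close> \<open>b \<notin> A\<close> d1 d2 xa xb \<open>0 < \<delta>\<close> by (intro that[of a b x f g]) auto
qed

section \<open>Passing to the limit\<close>

lemma subtransversal_bound_limiting_normals:
  assumes sub: "subtransversal_with A B xbar \<alpha>" and "0 \<le> \<alpha>" and xbar: "xbar \<in> A \<inter> B"
    and fg: "(f, g) \<in> restricted_limiting_normals A B xbar"
  shows "\<alpha> * (norm f + norm g) \<le> norm (f + g)"
proof -
  obtain a b x fk gk where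
    ab: "\<And>k::nat. a k \<in> A - B" "\<And>k. b k \<in> B - A" "\<And>k. norm (x k - a k) = norm (x k - b k)"
    and lim: "x \<longlonglongrightarrow> xbar" "fk \<longlonglongrightarrow> f" "gk \<longlonglongrightarrow> g"
      "(\<lambda>k. infdist (fk k) (normal_cone A (a k))) \<longlonglongrightarrow> 0"
      "(\<lambda>k. infdist (gk k) (normal_cone B (b k))) \<longlonglongrightarrow> 0"
    and dual: "\<And>k. blinfun_apply (fk k) (x k - a k) = norm (fk k) * norm (x k - a k)"
      "\<And>k. blinfun_apply (gk k) (x k - b k) = norm (gk k) * norm (x k - b k)"
    using fg unfolding restricted_limiting_normals_def by blast
  obtain \<delta> where \<delta>: "0 < \<delta>"
    "\<And>x. x \<in> ball xbar \<delta> \<Longrightarrow> \<alpha> * infdist x (A \<inter> B) \<le> max (infdist x A) (infdist x B)"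
    using sub unfolding subtransversal_with_def by blast
  define \<epsilon> where
    "\<epsilon> k = max (infdist (fk k) (normal_cone A (a k))) (infdist (gk k) (normal_cone B (b k)))" for k
  have \<epsilon>: "\<epsilon> \<longlonglongrightarrow> 0"
    using tendsto_max[OF lim(4,5)] by (simp add: \<epsilon>_def[abs_def])
  have "\<forall>\<^sub>F k in sequentially. x k \<in> ball xbar \<delta>"
    using lim(1) \<delta>(1) by (intro topological_tendstoD) auto
  then have "\<forall>\<^sub>F k in sequentially.
    \<alpha> * (norm (fk k) + norm (gk k) - 2 * \<epsilon> k) \<le> norm (fk k + gk k) + 2 * \<epsilon> k"
  proof eventually_elim
    case (elim k)
    show ?case
      using xbar ab[of k] dual[of k] \<delta>(2)[OF elim] assms(2)
      by (intro approx_normals_bound[where A = A and B = B and a = "a k" and b = "b k" and x = "x k"])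
        (auto simp: \<epsilon>_def)
  qed
  moreover have "(\<lambda>k. norm (fk k + gk k) + 2 * \<epsilon> k) \<longlonglongrightarrow> norm (f + g) + 2 * 0"
    by (intro tendsto_intros lim \<epsilon>)
  moreover have "(\<lambda>k. \<alpha> * (norm (fk k) + norm (gk k) - 2 * \<epsilon> k))
      \<longlonglongrightarrow> \<alpha> * (norm f + norm g - 2 * 0)"
    by (intro tendsto_intros lim \<epsilon>)
  ultimately have "\<alpha> * (norm f + norm g - 2 * 0) \<le> norm (f + g) + 2 * 0"
    by (intro tendsto_le[OF sequentially_bot]) auto
  then show ?thesis by simp
qed

text \<open>
  The exact normals at scale \<open>1 / (n + 1)\<close> lie in the unit ball of the dual, which is compact. A varying
  sequence of constants is allowed so that \<open>l = 0\<close>, where the normals cancel completely, is covered.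
\<close>

lemma limiting_normals_of_not_subtransversal:
  fixes A B :: "'a::real_normed_vector set"
  assumes fin: "\<exists>S::'a set. finite S \<and> span S = UNIV"
    and A: "closed A" "convex A" and B: "closed B" "convex B"
    and xbar: "xbar \<in> A \<inter> B"
    and \<alpha>: "\<And>n::nat. 0 < \<alpha> n \<and> \<alpha> n < 1" and not_sub: "\<And>n. \<not> subtransversal_with A B xbar (\<alpha> n)"
    and lim: "\<alpha> \<longlonglongrightarrow> l"
  obtains f g where "(f, g) \<in> restricted_limiting_normals A B xbar" "norm f + norm g = 1"
    "norm (f + g) \<le> l"
proof -
  define \<delta> where "\<delta> n = inverse (real (Suc n))" for n
  have \<delta>: "0 < \<delta> n" for n by (simp add: \<delta>_def)
  have \<delta>lim: "\<delta> \<longlonglongrightarrow> 0" unfolding \<delta>_def by (rule LIMSEQ_inverse_real_of_nat)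
  have "\<exists>f g a b x. a \<in> (A - B) \<inter> ball xbar (\<delta> n) \<and> b \<in> (B - A) \<inter> ball xbar (\<delta> n) \<and> x \<in> ball xbar (\<delta> n) \<and>
    norm (x - a) = norm (x - b) \<and> f \<in> normal_cone A a \<and> g \<in> normal_cone B b \<and>
    norm f + norm g = 1 \<and>
    blinfun_apply f (x - a) = norm f * norm (x - a) \<and>
    blinfun_apply g (x - b) = norm g * norm (x - b) \<and>
    norm (f + g) \<le> \<alpha> n" for n
    by (rule exact_normals_of_not_subtransversal[OF fin A B xbar _ _ not_sub \<delta>, of n n]) (use \<alpha> in blast)+
  then obtain f g a b x where
    ab: "\<And>n. a n \<in> (A - B) \<inter> ball xbar (\<delta> n)" "\<And>n. b n \<in> (B - A) \<inter> ball xbar (\<delta> n)"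
      "\<And>n. x n \<in> ball xbar (\<delta> n)" "\<And>n. norm (x n - a n) = norm (x n - b n)"
    and fg: "\<And>n. f n \<in> normal_cone A (a n)" "\<And>n. g n \<in> normal_cone B (b n)"
      "\<And>n. norm (f n) + norm (g n) = 1"
      "\<And>n. blinfun_apply (f n) (x n - a n) = norm (f n) * norm (x n - a n)"
      "\<And>n. blinfun_apply (g n) (x n - b n) = norm (g n) * norm (x n - b n)"
      "\<And>n. norm (f n + g n) \<le> \<alpha> n"
    by metis
  have ball_lim: "y \<longlonglongrightarrow> xbar" if "\<And>n. y n \<in> ball xbar (\<delta> n)" for y
  proof (rule metric_tendsto_imp_tendsto[OF \<delta>lim])
    show "\<forall>\<^sub>F n in sequentially. dist (y n) xbar \<le> dist (\<delta> n) 0"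
      using that \<delta> by (intro always_eventually allI) (simp add: dist_commute less_imp_le)
  qed
  have "compact (cball (0 :: 'a \<Rightarrow>\<^sub>L real) 1)"
    using finite_dim_dual[OF fin] by (intro finite_dim_compact) auto
  then have "seq_compact (cball (0 :: 'a \<Rightarrow>\<^sub>L real) 1 \<times> cball (0 :: 'a \<Rightarrow>\<^sub>L real) 1)"
    by (intro compact_imp_seq_compact compact_Times)
  moreover have "\<forall>n. (f n, g n) \<in> cball 0 1 \<times> cball 0 1"
  proof
    fix n show "(f n, g n) \<in> cball 0 1 \<times> cball 0 1"
      using fg(3)[of n] norm_ge_zero[of "f n"] norm_ge_zero[of "g n"]
      by (simp del: norm_ge_zero)
  qed
  ultimately obtain z and s :: "nat \<Rightarrow> nat" where s: "strict_mono s"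
    and lim': "((\<lambda>n. (f n, g n)) \<circ> s) \<longlonglongrightarrow> z"
    by (rule seq_compactE)
  define f' g' where "f' = fst z" and "g' = snd z"
  have f': "(\<lambda>n. f (s n)) \<longlonglongrightarrow> f'" and g': "(\<lambda>n. g (s n)) \<longlonglongrightarrow> g'"
    using tendsto_fst[OF lim'] tendsto_snd[OF lim'] by (simp_all add: o_def f'_def g'_def)
  have sub: "(\<lambda>n. y (s n)) \<longlonglongrightarrow> z" if "y \<longlonglongrightarrow> z" for y :: "nat \<Rightarrow> 'b::topological_space" and z
    using LIMSEQ_subseq_LIMSEQ[OF that s] by (simp add: o_def)
  show ?thesis
  proof (rule that)
    have "(\<lambda>n. a (s n)) \<longlonglongrightarrow> xbar" "(\<lambda>n. b (s n)) \<longlonglongrightarrow> xbar" "(\<lambda>n. x (s n)) \<longlonglongrightarrow> xbar"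
      by (rule sub, rule ball_lim, use ab in blast)+
    then show "(f', g') \<in> restricted_limiting_normals A B xbar"
      unfolding restricted_limiting_normals_def
      using ab fg f' g'
      by (intro CollectI case_prodI exI[of _ "\<lambda>n. a (s n)"] exI[of _ "\<lambda>n. b (s n)"]
          exI[of _ "\<lambda>n. x (s n)"] exI[of _ "\<lambda>n. f (s n)"] exI[of _ "\<lambda>n. g (s n)"]) auto
    have "(\<lambda>n. norm (f (s n)) + norm (g (s n))) \<longlonglongrightarrow> norm f' + norm g'"
      by (intro tendsto_intros f' g')
    then show "norm f' + norm g' = 1"
      using fg(3) by (simp add: LIMSEQ_const_iff)
    have "(\<lambda>n. norm (f (s n) + g (s n))) \<longlonglongrightarrow> norm (f' + g')"
      by (intro tendsto_intros f' g')
    then show "norm (f' + g') \<le> l"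
      using fg(6) by (intro LIMSEQ_le[OF _ sub[OF lim]]) auto
  qed
qed

text \<open>
  This serves to compare the subtransversality constants \<open>S\<close> with the strict lower bounds \<open>T\<close> of
  \<open>norm (f + g)\<close> over the limiting normals. Both form initial intervals of \<open>]0,1[\<close>, and they may differ only in
  whether the endpoint belongs to them.
\<close>

lemma sup_or_zero_eqI:
  assumes S: "S \<subseteq> {0<..<1}" and T: "T \<subseteq> S" and below: "\<And>s t. s \<in> S \<Longrightarrow> 0 < t \<Longrightarrow> t < s \<Longrightarrow> t \<in> T"
  shows "sup_or_zero T = sup_or_zero S"
proof (cases "S = {}")
  case False
  then obtain s where s: "s \<in> S" by blast
  then have "s / 2 \<in> T" using S below[of s "s / 2"] by force
  then have ne: "T \<noteq> {}" by blast
  have "bdd_above S" using S by (intro bdd_aboveI[of _ 1]) auto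
  then have le: "Sup T \<le> Sup S" and bdd: "bdd_above T"
    using cSup_subset_mono[OF ne _ T] bdd_above_mono[OF _ T] by auto
  have "s \<le> Sup T" if s: "s \<in> S" for s
  proof (rule dense_le_bounded[of 0])
    show "t \<le> Sup T" if "0 < t" "t < s" for t
      using below[OF s that] bdd by (rule cSup_upper)
  qed (use S s in auto)
  then have "Sup S \<le> Sup T" using False by (intro cSup_least)
  then show ?thesis using le ne False by (simp add: sup_or_zero_def)
qed (use T in simp)

text \<open>
  In the definition of \<open>str_c\<close> the radius \<open>\<delta>\<close> is also the normality error, so \<open>approx_normals_bound\<close> with
  \<open>\<epsilon> = \<delta>\<close> bounds all values at scale \<open>\<delta>\<close> from below by \<open>\<alpha> * (1 - 2 * \<delta>) - 2 * \<delta> \<ge> \<alpha> - 4 * \<delta>\<close>.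
\<close>

lemma str_c_ge_of_subtransversal:
  assumes sub: "subtransversal_with A B xbar \<alpha>" and \<alpha>: "0 < \<alpha>" "\<alpha> < 1" and xbar: "xbar \<in> A \<inter> B"
  shows "\<alpha> \<le> str_c A B xbar"
proof -
  obtain \<delta>0 where \<delta>0: "0 < \<delta>0"
    "\<And>x. x \<in> ball xbar \<delta>0 \<Longrightarrow> \<alpha> * infdist x (A \<inter> B) \<le> max (infdist x A) (infdist x B)"
    using sub unfolding subtransversal_with_def by blast
  have *: "\<alpha> - 4 * \<delta> \<le> inf_or_one (str_c_values A B xbar \<delta>)" if \<delta>: "0 < \<delta>" "\<delta> < \<delta>0" for \<delta>
  proof -
    have "\<alpha> - 4 * \<delta> \<le> t" if t: "t \<in> str_c_values A B xbar \<delta>" for t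
    proof -
      obtain f g a b x where t: "t = norm (f + g)"
        "a \<in> (A - B) \<inter> ball xbar \<delta>" "b \<in> (B - A) \<inter> ball xbar \<delta>" "x \<in> ball xbar \<delta>"
        "norm (x - a) = norm (x - b)"
        "infdist f (normal_cone A a) < \<delta>" "infdist g (normal_cone B b) < \<delta>"
        "norm f + norm g = 1"
        "blinfun_apply f (x - a) = norm f * norm (x - a)"
        "blinfun_apply g (x - b) = norm g * norm (x - b)"
        using t unfolding str_c_values_def by blast
      have "\<alpha> * (norm f + norm g - 2 * \<delta>) \<le> norm (f + g) + 2 * \<delta>"
        using t \<alpha> xbar \<delta> \<delta>0(2)[of x]
        by (intro approx_normals_bound[where A = A and B = B and a = a and b = b and x = x]) auto
      moreover have "\<alpha> * \<delta> \<le> \<delta>" using \<alpha> \<delta> by simp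
      ultimately show ?thesis using t by (simp add: algebra_simps)
    qed
    then show ?thesis
      using \<alpha> \<delta> by (auto simp: inf_or_one_def intro: cInf_greatest)
  qed
  have "((\<lambda>\<delta>. \<alpha> - 4 * \<delta>) \<longlongrightarrow> \<alpha> - 4 * 0) (at_right 0)"
    by (intro tendsto_intros)
  then have lim: "((\<lambda>\<delta>. \<alpha> - 4 * \<delta>) \<longlongrightarrow> \<alpha>) (at_right 0)" by simp
  have "\<forall>\<^sub>F \<delta> in at_right 0. \<alpha> - 4 * \<delta> \<le> inf_or_one (str_c_values A B xbar \<delta>)"
    unfolding eventually_at_right_field using * \<delta>0(1) by blast
  then show ?thesis
    by (intro tendsto_le[OF _ tendsto_str_c lim]) simp_all
qed

lemma str_c_le_of_not_subtransversal:
  fixes A B :: "'a::real_normed_vector set"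
  assumes fin: "\<exists>S::'a set. finite S \<and> span S = UNIV"
    and A: "closed A" "convex A" and B: "closed B" "convex B"
    and xbar: "xbar \<in> A \<inter> B"
    and \<alpha>: "0 < \<alpha>" "\<alpha> < 1" and not_sub: "\<not> subtransversal_with A B xbar \<alpha>"
  shows "str_c A B xbar \<le> \<alpha>"
proof (rule tendsto_upperbound[OF tendsto_str_c])
  have "inf_or_one (str_c_values A B xbar \<delta>) \<le> \<alpha>" if \<delta>: "0 < \<delta>" for \<delta>
  proof -
    obtain f g a b x where w:
      "a \<in> (A - B) \<inter> ball xbar \<delta>" "b \<in> (B - A) \<inter> ball xbar \<delta>" "x \<in> ball xbar \<delta>"
      "norm (x - a) = norm (x - b)" "f \<in> normal_cone A a" "g \<in> normal_cone B b"
      "norm f + norm g = 1"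
      "blinfun_apply f (x - a) = norm f * norm (x - a)"
      "blinfun_apply g (x - b) = norm g * norm (x - b)"
      "norm (f + g) \<le> \<alpha>"
      by (rule exact_normals_of_not_subtransversal[OF fin A B xbar \<alpha> not_sub \<delta>])
    then have "norm (f + g) \<in> str_c_values A B xbar \<delta>"
      unfolding str_c_values_def using \<delta>
      by (intro CollectI exI[of _ f] exI[of _ g] exI[of _ a] exI[of _ b] exI[of _ x]) auto
    then have "Inf (str_c_values A B xbar \<delta>) \<le> \<alpha>"
      using w(10) str_c_values_bdd_below by (rule cInf_lower2)
    then show ?thesis
      using \<open>norm (f + g) \<in> str_c_values A B xbar \<delta>\<close> by (auto simp: inf_or_one_def)
  qed
  then show "\<forall>\<^sub>F \<delta> in at_right 0. inf_or_one (str_c_values A B xbar \<delta>) \<le> \<alpha>"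
    by (intro eventually_mono[OF eventually_at_right_less])
qed simp

section \<open>Characterisation of subtransversality by restricted limiting normals\<close>

theorem theorem6:
  fixes A B :: "'a::real_normed_vector set" and xbar :: 'a
  assumes finite_dim: "\<exists>S::'a set. finite S \<and> span S = UNIV"
    and "closed A" and "convex A"
    and "closed B" and "convex B"
    and "xbar \<in> A \<inter> B"
  shows "(subtransversal A B xbar \<longleftrightarrow>
            (\<exists>\<alpha>\<in>{0<..<1}. \<forall>(f, g)\<in>restricted_limiting_normals A B xbar.
               norm f + norm g = 1 \<longrightarrow> norm (f + g) > \<alpha>))
       \<and> (subtransversal A B xbar \<longleftrightarrow>
            {f. (f, - f) \<in> restricted_limiting_normals A B xbar} \<subseteq> {0})
       \<and> sup_or_zero {\<alpha>\<in>{0<..<1}. \<forall>(f, g)\<in>restricted_limiting_normals A B xbar.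
               norm f + norm g = 1 \<longrightarrow> norm (f + g) > \<alpha>} = str A B xbar
       \<and> str A B xbar = str_c A B xbar"
proof -
  let ?N = "restricted_limiting_normals A B xbar"
  define S where "S = {\<alpha>\<in>{0<..<1}. subtransversal_with A B xbar \<alpha>}"
  define T where "T = {\<alpha>\<in>{0<..<1}. \<forall>(f, g)\<in>?N. norm f + norm g = 1 \<longrightarrow> norm (f + g) > \<alpha>}"
  note limiting = limiting_normals_of_not_subtransversal[OF assms]
  have TS: "T \<subseteq> S"
  proof
    fix \<alpha> assume \<alpha>: "\<alpha> \<in> T"
    show "\<alpha> \<in> S"
    proof (rule ccontr)
      assume "\<alpha> \<notin> S"
      with \<alpha> have "\<not> subtransversal_with A B xbar \<alpha>" "0 < \<alpha> \<and> \<alpha> < 1" by (auto simp: S_def T_def)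
      then obtain f g where "(f, g) \<in> ?N" "norm f + norm g = 1" "norm (f + g) \<le> \<alpha>"
        using limiting[of "\<lambda>_. \<alpha>" \<alpha>] by auto
      then show False using \<alpha> by (auto simp: T_def)
    qed
  qed
  have below: "t \<in> T" if "s \<in> S" "0 < t" "t < s" for s t
  proof -
    have "s * (norm f + norm g) \<le> norm (f + g)" if "(f, g) \<in> ?N" for f g
      using \<open>s \<in> S\<close> that assms(6)
      by (intro subtransversal_bound_limiting_normals[of A B xbar]) (auto simp: S_def)
    then show ?thesis using that by (fastforce simp: S_def T_def)
  qed
  have "subtransversal A B xbar \<longleftrightarrow> S \<noteq> {}"
    by (auto simp: subtransversal_def S_def)
  moreover have "S \<noteq> {} \<longleftrightarrow> T \<noteq> {}"
  proof
    assume "S \<noteq> {}"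
    then obtain s where "s \<in> S" by blast
    moreover from this have "0 < s" by (simp add: S_def)
    ultimately show "T \<noteq> {}" using below[of s "s / 2"] by auto
  qed (use TS in blast)
  moreover have "T \<noteq> {} \<longleftrightarrow> (\<exists>\<alpha>\<in>{0<..<1}. \<forall>(f, g)\<in>?N. norm f + norm g = 1 \<longrightarrow> norm (f + g) > \<alpha>)"
    by (auto simp: T_def)
  moreover have "S \<noteq> {} \<longleftrightarrow> {f. (f, - f) \<in> ?N} \<subseteq> {0}"
  proof
    assume "S \<noteq> {}"
    then obtain s where s: "0 < s" "subtransversal_with A B xbar s" by (auto simp: S_def)
    have "f = 0" if "(f, - f) \<in> ?N" for f
    proof -
      have "s * (norm f + norm f) \<le> 0"
        using subtransversal_bound_limiting_normals[OF s(2) _ assms(6) that] s(1) by simp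
      then show ?thesis using s(1) by (simp add: mult_le_0_iff)
    qed
    then show "{f. (f, - f) \<in> ?N} \<subseteq> {0}" by blast
  next
    assume sub: "{f. (f, - f) \<in> ?N} \<subseteq> {0}"
    show "S \<noteq> {}"
    proof
      assume "S = {}"
      \<comment> \<open>No constant works, so constants tending to 0 produce limiting normals with sum 0. They start at
         \<open>1 / 2\<close> to stay below 1.\<close>
      define \<alpha> where "\<alpha> n = inverse (real (Suc (Suc n)))" for n
      have \<alpha>: "0 < \<alpha> n \<and> \<alpha> n < 1" for n by (simp add: \<alpha>_def inverse_less_1_iff)
      have "\<alpha> \<longlonglongrightarrow> 0"
        unfolding \<alpha>_def by (rule LIMSEQ_Suc[OF LIMSEQ_inverse_real_of_nat])
      moreover have "\<not> subtransversal_with A B xbar (\<alpha> n)" for n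
        using \<open>S = {}\<close> \<alpha>[of n] by (auto simp: S_def)
      ultimately obtain f g where fg: "(f, g) \<in> ?N" "norm f + norm g = 1" "norm (f + g) \<le> 0"
        using limiting[of \<alpha> 0] \<alpha> by metis
      then have "g = - f" by (simp add: eq_neg_iff_add_eq_0 add.commute)
      then have "f = 0" using sub fg(1) by blast
      then show False using fg(2) \<open>g = - f\<close> by simp
    qed
  qed
  moreover have "sup_or_zero T = sup_or_zero S"
    using TS below by (intro sup_or_zero_eqI) (auto simp: S_def)
  moreover have strS: "str A B xbar = sup_or_zero S"
    by (simp add: str_def S_def)
  moreover have "str A B xbar = str_c A B xbar"
  proof (rule antisym)
    have "0 \<le> str_c A B xbar"
    proof (rule tendsto_lowerbound[OF tendsto_str_c])
      show "\<forall>\<^sub>F \<delta> in at_right 0. 0 \<le> inf_or_one (str_c_values A B xbar \<delta>)"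
        by (intro always_eventually)
          (auto simp: inf_or_one_def intro!: cInf_greatest dest: str_c_values_bounds(1))
    qed simp
    moreover have "s \<le> str_c A B xbar" if "s \<in> S" for s
      using that assms(6) by (intro str_c_ge_of_subtransversal) (auto simp: S_def)
    ultimately show "str A B xbar \<le> str_c A B xbar"
      unfolding strS sup_or_zero_def by (auto intro: cSup_least)
    have bdd: "bdd_above S" by (auto simp: S_def intro: bdd_aboveI[of _ 1])
    have str0: "0 \<le> str A B xbar"
      unfolding strS sup_or_zero_def using bdd
      by (auto simp: S_def intro: cSup_upper2 less_imp_le)
    show "str_c A B xbar \<le> str A B xbar"
    proof (rule dense_ge)
      fix \<alpha> assume \<alpha>: "str A B xbar < \<alpha>"
      show "str_c A B xbar \<le> \<alpha>"
      proof (cases "\<alpha> < 1")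
        case True
        have "\<alpha> \<notin> S"
        proof
          assume "\<alpha> \<in> S"
          then have "\<alpha> \<le> Sup S" "S \<noteq> {}" using bdd by (auto intro: cSup_upper)
          then show False using \<alpha> by (simp add: strS sup_or_zero_def)
        qed
        then have "\<not> subtransversal_with A B xbar \<alpha>"
          using \<alpha> str0 True by (auto simp: S_def)
        then show ?thesis
          using \<alpha> str0 True by (intro str_c_le_of_not_subtransversal[OF assms]) auto
      next
        case False
        have "str_c A B xbar \<le> 1"
          by (rule tendsto_upperbound[OF tendsto_str_c always_eventually])
            (simp_all add: inf_or_one_str_c_values_le)
        then show ?thesis using False by simp
      qed
    qed
  qed
  ultimately show ?thesis by (simp add: T_def)
qed

end
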